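(* Let $0<x_1<x_2<\cdots$ be an infinite sequence of integers (trap positions on $\mathbb{Z}_{>0}$). If, for every real $a>1$, there exists $k\ge 1$ such that $x_k>a^{2^k}$, then the model with traps $(x_k)_{k\ge1}$ is critical.
   Context: The model is the trapped random walk on the half-line: with $D_+=\{x_k\}_{k\ge1}$, it is the Markov chain on $\{0,1,2,\dots\}\cup\{s\}$ where $s$ (the sink) and $0$ are absorbing, from $x\ge 1$ with $x\notin D_+$ the walk moves to $x-1$ or $x+1$ with probability $1/2$ each, and from $x\in D_+$ it moves to $x-1$, $x+1$ or $s$ with probability $1/3$ each. Let $T$ be the first time the walk is in $\{0,s\}$, and let $\mathbb{E}_x(T)\in[0,\infty]$ be its expectation for the walk started at $x$. The model is called critical if $\mathbb{E}_1(T)=\infty$ and non-critical if $\mathbb{E}_1(T)<\infty$ (the finiteness of $\mathbb{E}_x(T)$ does not depend on the starting point $x\ge 1$). *)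

theory Defs
  imports "HOL-Probability.Probability"
begin

datatype state = Site nat | Sink

instance state :: countable
  by countable_datatype

fun step :: "nat set \<Rightarrow> state \<Rightarrow> state pmf" where
  "step D Sink = return_pmf Sink"
| "step D (Site 0) = return_pmf (Site 0)"
| "step D (Site (Suc m)) =
     (if Suc m \<in> D then pmf_of_set {Site m, Site (m + 2), Sink}
      else pmf_of_set {Site m, Site (m + 2)})"

text \<open>Law of the position at time \<open>n\<close>, given the positions at times \<open>0, \<dots>, n - 1\<close>, for the walk
  started at \<open>s\<close>.\<close>

definition next_law :: "nat set \<Rightarrow> state \<Rightarrow> nat \<Rightarrow> (nat \<Rightarrow> state) \<Rightarrow> state measure" where
  "next_law D s n \<omega> = measure_pmf (case n of 0 \<Rightarrow> return_pmf s | Suc m \<Rightarrow> step D (\<omega> m))"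

lemma Ionescu_Tulcea_next_law: "Ionescu_Tulcea (next_law D s) (\<lambda>_. count_space UNIV)"
proof (rule Ionescu_Tulcea.intro)
  show "next_law D s n \<in> PiM {0..<n} (\<lambda>_. count_space UNIV) \<rightarrow>\<^sub>M subprob_algebra (count_space UNIV)" for n
  proof (cases n)
    case 0
    then show ?thesis by (simp add: next_law_def[abs_def] measure_pmf_in_subprob_algebra)
  next
    case (Suc m)
    have "(\<lambda>\<omega>. \<omega> m) \<in> PiM {0..<n} (\<lambda>_. count_space UNIV :: state measure) \<rightarrow>\<^sub>M count_space UNIV"
      using Suc by (intro measurable_component_singleton) simp
    from measurable_compose[OF this measurable_measure_pmf[of "step D"]] show ?thesis
      using Suc by (simp add: next_law_def[abs_def])
  qed
  show "prob_space (next_law D s n \<omega>)" for n \<omega>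
    unfolding next_law_def by (rule prob_space_measure_pmf)
qed

text \<open>The law, on the space of trajectories, of the Markov chain with transition kernel
  \<^term>\<open>step D\<close> started at \<open>s\<close>: the projective limit provided by the Ionescu-Tulcea theorem. It is
  characterised by \<open>emeasure_walk_prefix\<close> below.\<close>

definition walk :: "nat set \<Rightarrow> state \<Rightarrow> (nat \<Rightarrow> state) measure" where
  "walk D s = projective_family.lim UNIV
     (Ionescu_Tulcea.CI (next_law D s) (\<lambda>_. count_space UNIV)) (\<lambda>_. count_space UNIV)"

definition absorption_time :: "(nat \<Rightarrow> state) \<Rightarrow> enat" where
  "absorption_time \<omega> = (INF n \<in> {n. \<omega> n \<in> {Site 0, Sink}}. enat n)"

definition expected_absorption_time :: "nat set \<Rightarrow> nat \<Rightarrow> ennreal" where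
  "expected_absorption_time D x =
     (\<integral>\<^sup>+ \<omega>. ennreal_of_enat (absorption_time \<omega>) \<partial>walk D (Site x))"

definition critical :: "nat set \<Rightarrow> bool" where
  "critical D \<longleftrightarrow> expected_absorption_time D 1 = \<infinity>"

lemma sets_walk [measurable_cong, simp]: "sets (walk D s) = sets (PiM UNIV (\<lambda>_. count_space UNIV))"
proof -
  interpret Ionescu_Tulcea "next_law D s" "\<lambda>_. count_space UNIV"
    by (rule Ionescu_Tulcea_next_law)
  show ?thesis by (simp add: walk_def)
qed

lemma space_walk [simp]: "space (walk D s) = UNIV"
  using sets_eq_imp_space_eq[OF sets_walk] by (simp add: space_PiM)

lemma emeasure_walk_prefix:
  "emeasure (walk D s) {\<omega>. \<forall>i\<le>n. \<omega> i = w i} =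
     ennreal (indicator {s} (w 0) * (\<Prod>i<n. pmf (step D (w i)) (w (Suc i))))"
proof -
  interpret Ionescu_Tulcea "next_law D s" "\<lambda>_. count_space UNIV"
    by (rule Ionescu_Tulcea_next_law)
  let ?M = "\<lambda>k. PiM {0..<k} (\<lambda>_. count_space UNIV :: state measure)"
  define pre where "pre k = restrict w {0..<k}" for k
  have pre_space: "pre k \<in> space (?M k)" for k
    by (simp add: pre_def space_PiM)
  have pre_sets [measurable]: "{pre k} \<in> sets (?M k)" for k
  proof -
    have "{pre k} = (\<Pi>\<^sub>E i\<in>{0..<k}. {w i})"
      by (auto simp: pre_def PiE_iff extensional_def restrict_def fun_eq_iff)
    then show ?thesis by (simp add: sets_PiM_I_finite)
  qed
  have eP_pre: "emeasure (eP k \<omega>) {pre (Suc k)} =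
      emeasure (next_law D s k (pre k)) {w k} * indicator {pre k} \<omega>" if "\<omega> \<in> space (?M k)" for k \<omega>
  proof -
    have "fun_upd \<omega> k x = pre (Suc k) \<longleftrightarrow> \<omega> = pre k \<and> x = w k" for x
    proof
      assume eq: "fun_upd \<omega> k x = pre (Suc k)"
      have "\<omega> i = pre k i" for i
        using fun_cong[OF eq, of i] that
        by (cases "i = k") (auto simp: pre_def space_PiM PiE_iff extensional_def restrict_def split: if_splits)
      moreover have "x = w k"
        using fun_cong[OF eq, of k] by (simp add: pre_def)
      ultimately show "\<omega> = pre k \<and> x = w k" by auto
    qed (auto simp: pre_def fun_eq_iff)
    then have "(\<lambda>x. fun_upd \<omega> k x) -` {pre (Suc k)} \<inter> UNIV = (if \<omega> = pre k then {w k} else {})"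
      by auto
    then show ?thesis
      using that by (simp add: emeasure_eP)
  qed
  have C_pre: "emeasure (C 0 (Suc k) (\<lambda>_. undefined)) {pre (Suc k)} =
      emeasure (next_law D s k (pre k)) {w k} * emeasure (C 0 k (\<lambda>_. undefined)) {pre k}" for k
  proof -
    have sp: "space (C 0 k (\<lambda>_. undefined)) = space (?M k)"
      using space_C[of "\<lambda>_. undefined" 0 k] by (simp add: space_PiM)
    have se: "sets (C 0 k (\<lambda>_. undefined)) = sets (?M k)"
      using sets_C[of "\<lambda>_. undefined" 0 k] by (simp add: space_PiM)
    have "emeasure (C 0 (Suc k) (\<lambda>_. undefined)) {pre (Suc k)} =
        (\<integral>\<^sup>+ \<omega>. emeasure (eP k \<omega>) {pre (Suc k)} \<partial>C 0 k (\<lambda>_. undefined))"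
      using pre_space[of k]
      by (simp, subst emeasure_bind[where N = "?M (Suc k)"])
        (auto simp: sp measurable_cong_sets[OF se refl])
    also have "\<dots> = (\<integral>\<^sup>+ \<omega>. emeasure (next_law D s k (pre k)) {w k} * indicator {pre k} \<omega>
        \<partial>C 0 k (\<lambda>_. undefined))"
      by (intro nn_integral_cong eP_pre) (simp add: sp)
    also have "\<dots> = emeasure (next_law D s k (pre k)) {w k} * emeasure (C 0 k (\<lambda>_. undefined)) {pre k}"
      by (rule nn_integral_cmult_indicator) (simp add: se)
    finally show ?thesis .
  qed
  have "emeasure (C 0 (Suc n) (\<lambda>_. undefined)) {pre (Suc n)} =
     ennreal (indicator {s} (w 0) * (\<Prod>i<n. pmf (step D (w i)) (w (Suc i))))"
  proof (induction n)
    case 0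
    have "pre 0 = (\<lambda>_. undefined)" by (simp add: pre_def fun_eq_iff)
    then have "emeasure (C 0 0 (\<lambda>_. undefined)) {pre 0} = 1"
      using pre_sets[of 0] by simp
    then show ?case
      by (subst C_pre) (simp add: next_law_def emeasure_pmf_single pmf_return indicator_def)
  next
    case (Suc n)
    have "pre (Suc n) n = w n" by (simp add: pre_def)
    then show ?case
      by (subst C_pre, subst Suc.IH)
        (simp add: next_law_def emeasure_pmf_single ennreal_mult' mult_ac prod_nonneg)
  qed
  also have "emeasure (C 0 (Suc n) (\<lambda>_. undefined)) {pre (Suc n)} = emeasure (CI {0..<Suc n}) {pre (Suc n)}"
    by (subst emeasure_CI[of _ "Suc n"]) (use pre_space[of "Suc n"] in \<open>auto simp: prod_emb_id space_PiM simp del: C.simps\<close>)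
  also have "\<dots> = emeasure (walk D s) (prod_emb UNIV (\<lambda>_. count_space UNIV) {0..<Suc n} {pre (Suc n)})"
    unfolding walk_def by (rule lim[symmetric]) auto
  also have "prod_emb UNIV (\<lambda>_. count_space UNIV) {0..<Suc n} {pre (Suc n)} = {\<omega>. \<forall>i\<le>n. \<omega> i = w i}"
    by (auto simp: prod_emb_def pre_def space_PiM restrict_def fun_eq_iff less_Suc_eq_le)
      (metis less_Suc_eq_le)+
  finally show ?thesis by simp
qed

lemma prob_space_walk: "prob_space (walk D s)"
proof -
  interpret Ionescu_Tulcea "next_law D s" "\<lambda>_. count_space UNIV"
    by (rule Ionescu_Tulcea_next_law)
  have "emeasure (walk D s) (prod_emb UNIV (\<lambda>_. count_space UNIV) {} (space (PiM {} (\<lambda>_. count_space UNIV)))) =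
      emeasure (CI {}) (space (PiM {} (\<lambda>_. count_space UNIV)))"
    unfolding walk_def by (rule lim) auto
  also have "\<dots> = emeasure (CI {}) (space (CI {}))"
    by (simp add: CI_def)
  also have "\<dots> = 1"
    by (rule prob_space.emeasure_space_1[OF PF.prob_space_P]) auto
  also have "prod_emb UNIV (\<lambda>_. count_space UNIV) {} (space (PiM {} (\<lambda>_. count_space UNIV))) =
      (UNIV :: (nat \<Rightarrow> state) set)"
    by (auto simp: prod_emb_def space_PiM)
  finally show ?thesis by (intro prob_spaceI) simp
qed

lemma measurable_absorption_time [measurable]:
  "absorption_time \<in> PiM UNIV (\<lambda>_. count_space UNIV) \<rightarrow>\<^sub>M count_space UNIV"
proof -
  have eq: "absorption_time = (\<lambda>\<omega>. INF n. if \<omega> n \<in> {Site 0, Sink} then enat n else \<infinity>)"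
  proof
    fix \<omega>
    show "absorption_time \<omega> = (INF n. if \<omega> n \<in> {Site 0, Sink} then enat n else \<infinity>)"
      unfolding absorption_time_def
    proof (intro antisym INF_greatest)
      fix n
      show "(INF n \<in> {n. \<omega> n \<in> {Site 0, Sink}}. enat n) \<le> (if \<omega> n \<in> {Site 0, Sink} then enat n else \<infinity>)"
        by (auto intro: INF_lower)
    next
      fix n
      assume "n \<in> {n. \<omega> n \<in> {Site 0, Sink}}"
      then show "(INF n. if \<omega> n \<in> {Site 0, Sink} then enat n else \<infinity>) \<le> enat n"
        by (intro INF_lower2[of n]) auto
    qed
  qed
  show ?thesis
    unfolding eq by measurable
qed

end

theory Submission
  imports Defs
begin

text \<open>Write \<open>h n\<close> for the expected absorption time from \<open>n\<close> and suppose that \<open>h 1\<close> is finite.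
  By the Markov property \<open>h\<close> solves the one-step equations; in particular all its values are
  finite, and \<open>h n + n\<^sup>2\<close> is affine between consecutive traps. If \<open>L\<close> is the length
  of the gap to the right of the trap \<open>x k\<close>, this gives \<open>h (x (Suc k)) \<le> 3 L h (x k)\<close> and
  \<open>L \<le> 3 h (x k)\<close>, so \<open>x (Suc k)\<close> is at most a constant times \<open>3 ^ k\<close> times \<open>x 1 \<cdots> x k\<close>.
  The product of the first \<open>k\<close> traps is therefore essentially squared when \<open>k\<close> increases
  by one, whence \<open>x k \<le> a ^ 2 ^ k\<close> for some \<open>a > 1\<close> and all \<open>k \<ge> 1\<close>.\<close>

subsection \<open>The Markov property at time one\<close>

definition cylinder :: "nat \<Rightarrow> (nat \<Rightarrow> 'a) \<Rightarrow> (nat \<Rightarrow> 'a) set" where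
  "cylinder n w = {\<omega>. \<forall>i<n. \<omega> i = w i}"

lemma sets_cylinder [measurable]:
  "cylinder n w \<in> sets (PiM UNIV (\<lambda>_. count_space (UNIV :: 'a :: countable set)))"
proof -
  have "{\<omega> \<in> space (PiM UNIV (\<lambda>_. count_space UNIV)). \<forall>i<n. \<omega> i = w i} \<in>
      sets (PiM UNIV (\<lambda>_. count_space (UNIV :: 'a set)))"
    by measurable
  then show ?thesis by (simp add: cylinder_def space_PiM)
qed

text \<open>A common element of both cylinders serves as the prefix of their intersection. The empty
  case is why \<open>{}\<close> joins the generator below.\<close>

lemma cylinder_Int:
  "cylinder m v \<inter> cylinder n w = {} \<or> (\<exists>k u. cylinder m v \<inter> cylinder n w = cylinder k u)"
proof (cases "cylinder m v \<inter> cylinder n w = {}")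
  case False
  then obtain u where u: "u \<in> cylinder m v" "u \<in> cylinder n w" by blast
  then have "cylinder m v \<inter> cylinder n w = cylinder (max m n) u"
    by (auto simp: cylinder_def less_max_iff_disj)
  then show ?thesis by blast
qed simp

text \<open>Countability of the state type enters here: an event on coordinate \<open>i\<close> is a
  countable union of cylinders, one for each list of length \<open>Suc i\<close> with admissible
  last entry.\<close>

lemma sets_PiM_eq_sigma_cylinders:
  "sets (PiM UNIV (\<lambda>_. count_space (UNIV :: 'a :: countable set))) =
     sigma_sets UNIV (insert {} {cylinder n w |n w. True})"
proof
  let ?G = "insert {} {cylinder n w |n w. True} :: (nat \<Rightarrow> 'a) set set"
  have "{f. f i \<in> A} \<in> sigma_sets UNIV ?G" for i and A :: "'a set"
  proof -
    have "{f. f i \<in> A} = (\<Union>xs \<in> {xs. length xs = Suc i \<and> xs ! i \<in> A}. cylinder (Suc i) (\<lambda>j. xs ! j))"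
      (is "_ = ?R")
    proof (intro equalityI subsetI)
      fix f assume "f \<in> {f. f i \<in> A}"
      then show "f \<in> ?R"
        by (intro UN_I[of "map f [0..<Suc i]"]) (auto simp: cylinder_def simp del: upt_Suc)
    qed (auto simp: cylinder_def)
    moreover have "?R \<in> sigma_sets UNIV ?G"
      by (rule sigma_sets_UNION) auto
    ultimately show ?thesis by simp
  qed
  then have "sigma_sets UNIV {{f \<in> UNIV. f i \<in> A} |i A. True} \<subseteq> sigma_sets UNIV ?G"
    by (intro sigma_sets_mono) auto
  then show "sets (PiM UNIV (\<lambda>_. count_space (UNIV :: 'a set))) \<subseteq> sigma_sets UNIV ?G"
    by (simp add: sets_PiM_single)
  have "sigma_sets (space (PiM UNIV (\<lambda>_. count_space (UNIV :: 'a set)))) ?G \<subseteq>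
      sets (PiM UNIV (\<lambda>_. count_space (UNIV :: 'a set)))"
    by (rule sets.sigma_sets_subset) auto
  then show "sigma_sets UNIV ?G \<subseteq> sets (PiM UNIV (\<lambda>_. count_space (UNIV :: 'a set)))"
    by (simp add: space_PiM)
qed

lemma measure_eqI_cylinders:
  fixes M N :: "(nat \<Rightarrow> 'a :: countable) measure"
  assumes sets_M: "sets M = sets (PiM UNIV (\<lambda>_. count_space UNIV))"
    and sets_N: "sets N = sets (PiM UNIV (\<lambda>_. count_space UNIV))"
    and "prob_space M"
    and eq: "\<And>n w. emeasure M (cylinder n w) = emeasure N (cylinder n w)"
  shows "M = N"
proof (rule measure_eqI_generator_eq)
  let ?G = "insert {} {cylinder n w |n w. True} :: (nat \<Rightarrow> 'a) set set"
  \<comment> \<open>Length 0 prescribes nothing, so the whole space is in the generator and a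
    constant exhausting sequence suffices.\<close>
  have UNIV: "cylinder 0 w = UNIV" for w :: "nat \<Rightarrow> 'a"
    by (simp add: cylinder_def)
  show "Int_stable ?G"
  proof (rule Int_stableI)
    fix A B assume AB: "A \<in> ?G" "B \<in> ?G"
    show "A \<inter> B \<in> ?G"
    proof (cases "A = {} \<or> B = {}")
      case False
      with AB obtain m v n w where "A = cylinder m v" "B = cylinder n w" by auto
      then show ?thesis using cylinder_Int[of m v n w] by simp
    qed auto
  qed
  show "?G \<subseteq> Pow UNIV" by simp
  show "emeasure M X = emeasure N X" if "X \<in> ?G" for X
    using that eq by auto
  show "sets M = sigma_sets UNIV ?G" "sets N = sigma_sets UNIV ?G"
    using sets_M sets_N by (simp_all add: sets_PiM_eq_sigma_cylinders)
  show "range (\<lambda>_. UNIV) \<subseteq> ?G" using UNIV by blast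
  show "emeasure M UNIV \<noteq> \<infinity>" for i :: nat
    using finite_measure.emeasure_finite[OF prob_space.finite_measure[OF \<open>prob_space M\<close>]] by simp
qed simp

section \<open>Splitting the walk at its first step\<close>

lemma emeasure_walk_cylinder_0: "emeasure (walk D s) (cylinder 0 w) = 1"
  using prob_space.emeasure_space_1[OF prob_space_walk, of D s] by (simp add: cylinder_def)

lemma emeasure_walk_cylinder_Suc:
  "emeasure (walk D s) (cylinder (Suc n) w) =
     ennreal (indicator {s} (w 0) * (\<Prod>i<n. pmf (step D (w i)) (w (Suc i))))"
  using emeasure_walk_prefix[of D s n w] by (simp add: cylinder_def less_Suc_eq_le)

lemma measurable_case_nat_const [measurable]:
  "case_nat s \<in> PiM UNIV (\<lambda>_. count_space (UNIV :: 'a set)) \<rightarrow>\<^sub>M PiM UNIV (\<lambda>_. count_space UNIV)"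
proof (rule measurable_PiM_single')
  show "(\<lambda>\<omega>. case_nat s \<omega> i) \<in> PiM UNIV (\<lambda>_. count_space UNIV) \<rightarrow>\<^sub>M count_space UNIV" for i
    by (cases i) simp_all
qed (auto simp: space_PiM)

lemma case_nat_vimage_cylinder:
  "case_nat s -` cylinder (Suc n) w = (if w 0 = s then cylinder n (\<lambda>i. w (Suc i)) else {})"
  by (auto simp: cylinder_def less_Suc_eq_0_disj)

lemma prob_space_walk_case_nat:
  "prob_space (distr (walk D t) (PiM UNIV (\<lambda>_. count_space UNIV)) (case_nat s))"
  by (intro prob_space.prob_space_distr prob_space_walk) simp

lemma measurable_walk_case_nat:
  "(\<lambda>t. distr (walk D t) (PiM UNIV (\<lambda>_. count_space UNIV)) (case_nat s)) \<in>
     measure_pmf p \<rightarrow>\<^sub>M subprob_algebra (PiM UNIV (\<lambda>_. count_space UNIV))"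
  using prob_space_walk_case_nat[of D _ s]
  by (simp add: space_subprob_algebra prob_space_imp_subprob_space)

text \<open>Draw the state at time 1, run a fresh walk from it and prepend \<open>s\<close>. The two
  laws are compared on cylinders, where the probabilities are explicit products.\<close>

theorem walk_eq_bind:
  "walk D s = measure_pmf (step D s) \<bind>
     (\<lambda>t. distr (walk D t) (PiM UNIV (\<lambda>_. count_space UNIV)) (case_nat s))"
  (is "_ = Giry_Monad.bind _ ?K")
proof -
  let ?M = "PiM UNIV (\<lambda>_. count_space UNIV) :: (nat \<Rightarrow> state) measure"
  have emeasure_K: "emeasure (?K t) (cylinder (Suc n) w) =
      (if w 0 = s then emeasure (walk D t) (cylinder n (\<lambda>i. w (Suc i))) else 0)" for t n w
    by (subst emeasure_distr) (simp_all add: case_nat_vimage_cylinder)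
  have bind: "emeasure (measure_pmf (step D s) \<bind> ?K) (cylinder n w) =
      (\<integral>\<^sup>+ t. emeasure (?K t) (cylinder n w) \<partial>step D s)" for n w
    by (rule emeasure_bind[OF _ measurable_walk_case_nat sets_cylinder]) simp
  show ?thesis
  proof (rule measure_eqI_cylinders)
    show "sets (measure_pmf (step D s) \<bind> ?K) = sets ?M"
      by (rule sets_bind) auto
    fix n and w :: "nat \<Rightarrow> state"
    show "emeasure (walk D s) (cylinder n w) = emeasure (measure_pmf (step D s) \<bind> ?K) (cylinder n w)"
    proof (cases n)
      case 0
      have "emeasure (?K t) (cylinder 0 w) = 1" for t
        using prob_space.emeasure_space_1[OF prob_space_walk_case_nat, of D t s]
          by (simp add: cylinder_def space_PiM)
      then show ?thesis
        unfolding bind 0 by (simp add: emeasure_walk_cylinder_0 measure_pmf.emeasure_space_1[simplified])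
    next
      case (Suc m)
      show ?thesis
      proof (cases m)
        case 0
        then show ?thesis
          unfolding bind Suc 0 emeasure_K
          by (cases "w 0 = s")
            (simp_all add: emeasure_walk_cylinder_0 emeasure_walk_cylinder_Suc
              measure_pmf.emeasure_space_1[simplified])
      next
        case (Suc l)
        \<comment> \<open>The restarted walk must begin at \<open>w (Suc 0)\<close>; integrating
          this indicator over the first step yields the first transition factor, and
          \<open>?p\<close> collects the others.\<close>
        let ?p = "\<Prod>i<l. pmf (step D (w (Suc i))) (w (Suc (Suc i)))"
        have "(\<integral>\<^sup>+ t. ennreal (indicator {t} (w (Suc 0)) * ?p) \<partial>step D s) =
            (\<integral>\<^sup>+ t. ennreal ?p * indicator {w (Suc 0)} t \<partial>step D s)"
          by (intro nn_integral_cong) (auto simp: indicator_def)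
        also have "\<dots> = ennreal ?p * ennreal (pmf (step D s) (w (Suc 0)))"
          by (simp add: nn_integral_cmult_indicator emeasure_pmf_single)
        also have "\<dots> = ennreal (pmf (step D s) (w (Suc 0)) * ?p)"
          by (simp add: ennreal_mult' prod_nonneg mult.commute)
        finally show ?thesis
          unfolding bind \<open>n = Suc m\<close> emeasure_K
          by (cases "w 0 = s")
            (simp_all add: Suc emeasure_walk_cylinder_Suc prod.lessThan_Suc_shift del: prod.lessThan_Suc)
      qed
    qed
  qed (simp_all add: prob_space_walk)
qed

subsection \<open>One-step equations for the expected absorption time\<close>

text \<open>\<open>enat\<close> is well-ordered, so a nonempty infimum is attained; over the empty
  set both sides are infinite, which covers trajectories that are never absorbed.\<close>

lemma INF_eSuc: "(INF x \<in> A. eSuc (f x)) = eSuc (INF x \<in> A. f x)"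
proof (cases "A = {}")
  case False
  show ?thesis
  proof (rule antisym)
    have "(INF x \<in> A. f x) \<in> f ` A"
      using False by (auto intro: wellorder_InfI)
    then obtain a where "a \<in> A" "(INF x \<in> A. f x) = f a" by auto
    then show "(INF x \<in> A. eSuc (f x)) \<le> eSuc (INF x \<in> A. f x)"
      by (auto intro: INF_lower)
  qed (auto intro!: INF_greatest INF_lower)
qed (simp add: top_enat_def)

lemma absorption_time_case_nat:
  "absorption_time (case_nat s \<omega>) = (if s \<in> {Site 0, Sink} then 0 else eSuc (absorption_time \<omega>))"
proof (cases "s \<in> {Site 0, Sink}")
  case True
  then have "absorption_time (case_nat s \<omega>) \<le> enat 0"
    unfolding absorption_time_def by (intro INF_lower) auto
  with True show ?thesis by (simp add: zero_enat_def[symmetric])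
next
  case False
  have "{n. case_nat s \<omega> n \<in> {Site 0, Sink}} = Suc ` {n. \<omega> n \<in> {Site 0, Sink}}"
    using False by (auto simp: image_iff gr0_conv_Suc split: nat.splits)
  then show ?thesis
    using False by (auto simp: absorption_time_def image_image INF_eSuc eSuc_enat[symmetric])
qed

text \<open>Allowing any starting state, the sink included, makes this integrable against
  \<open>step D s\<close>.\<close>

definition mean_absorption :: "nat set \<Rightarrow> state \<Rightarrow> ennreal" where
  "mean_absorption D s = (\<integral>\<^sup>+ \<omega>. ennreal_of_enat (absorption_time \<omega>) \<partial>walk D s)"

text \<open>Condition on the first step by \<open>walk_eq_bind\<close>: prepending a non-absorbing
  state costs exactly one unit of time.\<close>

lemma mean_absorption_step:
  "mean_absorption D s =
     (if s \<in> {Site 0, Sink} then 0 else 1 + (\<integral>\<^sup>+ t. mean_absorption D t \<partial>step D s))"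
proof -
  let ?M = "PiM UNIV (\<lambda>_. count_space UNIV) :: (nat \<Rightarrow> state) measure"
  have "mean_absorption D s =
      (\<integral>\<^sup>+ t. \<integral>\<^sup>+ \<omega>. ennreal_of_enat (absorption_time \<omega>) \<partial>distr (walk D t) ?M (case_nat s) \<partial>step D s)"
    unfolding mean_absorption_def
    by (subst walk_eq_bind) (rule nn_integral_bind[OF _ measurable_walk_case_nat], measurable)
  also have "\<dots> = (\<integral>\<^sup>+ t. \<integral>\<^sup>+ \<omega>. ennreal_of_enat (absorption_time (case_nat s \<omega>)) \<partial>walk D t \<partial>step D s)"
    by (intro nn_integral_cong nn_integral_distr) measurable
  also have "\<dots> = (\<integral>\<^sup>+ t. (if s \<in> {Site 0, Sink} then 0 else 1 + mean_absorption D t) \<partial>step D s)"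
  proof (intro nn_integral_cong)
    fix t
    have "(\<integral>\<^sup>+ \<omega>. 1 + ennreal_of_enat (absorption_time \<omega>) \<partial>walk D t) = 1 + mean_absorption D t"
      using prob_space.emeasure_space_1[OF prob_space_walk, of D t]
      by (simp add: nn_integral_add mean_absorption_def)
    then show "(\<integral>\<^sup>+ \<omega>. ennreal_of_enat (absorption_time (case_nat s \<omega>)) \<partial>walk D t) =
        (if s \<in> {Site 0, Sink} then 0 else 1 + mean_absorption D t)"
      by (simp add: absorption_time_case_nat ennreal_of_enat_eSuc add.commute)
  qed
  also have "\<dots> = (if s \<in> {Site 0, Sink} then 0 else 1 + (\<integral>\<^sup>+ t. mean_absorption D t \<partial>step D s))"
    by (simp add: nn_integral_add measure_pmf.emeasure_space_1[simplified])
  finally show ?thesis .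
qed

lemma expected_absorption_time_eq: "expected_absorption_time D n = mean_absorption D (Site n)"
  by (simp add: expected_absorption_time_def mean_absorption_def)

lemma expected_absorption_time_0: "expected_absorption_time D 0 = 0"
  unfolding expected_absorption_time_eq by (subst mean_absorption_step) simp

text \<open>The sink contributes 0, so at a trap only the two neighbours remain in the sum, still
  divided by 3.\<close>

lemma expected_absorption_time_Suc:
  "expected_absorption_time D (Suc m) =
     1 + (expected_absorption_time D m + expected_absorption_time D (m + 2)) /
       (if Suc m \<in> D then 3 else 2)"
proof -
  have sink: "mean_absorption D Sink = 0"
    by (subst mean_absorption_step) simp
  have "(\<integral>\<^sup>+ t. mean_absorption D t \<partial>step D (Site (Suc m))) =
      (mean_absorption D (Site m) + mean_absorption D (Site (m + 2))) / (if Suc m \<in> D then 3 else 2)"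
    by (simp add: nn_integral_pmf_of_set sink add.assoc)
  moreover have "mean_absorption D (Site (Suc m)) =
      1 + (\<integral>\<^sup>+ t. mean_absorption D t \<partial>step D (Site (Suc m)))"
    by (subst mean_absorption_step) (simp del: step.simps)
  ultimately show ?thesis
    unfolding expected_absorption_time_eq by (simp only:)
qed

text \<open>The value at \<open>m + 2\<close> is a summand in the equation at \<open>Suc m\<close>,
  so finiteness propagates to the right.\<close>

lemma expected_absorption_time_finite:
  assumes "expected_absorption_time D 1 < \<infinity>"
  shows "expected_absorption_time D n < \<infinity>"
proof (cases n)
  case (Suc m)
  have "expected_absorption_time D (Suc m) < \<infinity>"
  proof (induction m)
    case (Suc m)
    then show ?case
      by (subst (asm) expected_absorption_time_Suc)
        (auto simp: ennreal_divide_eq_top_iff ennreal_add_eq_top less_top[symmetric] split: if_splits)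
  qed (use assms in simp)
  with Suc show ?thesis by simp
qed (simp add: expected_absorption_time_0)

lemma enn2real_expected_absorption_time_Suc:
  assumes "expected_absorption_time D 1 < \<infinity>"
  defines "h \<equiv> \<lambda>n. enn2real (expected_absorption_time D n)"
  shows "h (Suc m) = 1 + (h m + h (m + 2)) / (if Suc m \<in> D then 3 else 2)"
proof -
  \<comment> \<open>\<open>enn2real\<close> sends infinity to 0; finiteness makes the passage to
    reals faithful.\<close>
  have h: "expected_absorption_time D n = ennreal (h n)" "h n \<ge> 0" for n
    using expected_absorption_time_finite[OF assms(1), of n] by (simp_all add: h_def)
  define c :: real where "c = (if Suc m \<in> D then 3 else 2)"
  have c: "0 < c" "(if Suc m \<in> D then 3 else 2) = ennreal c"
    by (simp_all add: c_def)
  have "ennreal (h (Suc m)) = ennreal 1 + ennreal (h m + h (m + 2)) / ennreal c"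
    using expected_absorption_time_Suc[of D m] h(2) by (simp add: c(2) h(1))
  also have "\<dots> = ennreal (1 + (h m + h (m + 2)) / c)"
    using c(1) h(2) by (subst divide_ennreal, simp, simp, subst ennreal_plus) auto
  finally have "h (Suc m) = 1 + (h m + h (m + 2)) / c"
    using c(1) h(2) by (subst (asm) ennreal_inj) auto
  then show ?thesis by (simp add: c_def)
qed

subsection \<open>Growth of the traps in the non-critical case\<close>

text \<open>The second difference of \<open>f\<close> is -2, so \<open>f i + i\<^sup>2\<close> is
  affine and fixed by \<open>f 0\<close> and \<open>f 1\<close>. Evaluate it at \<open>L\<close> and
  solve for \<open>L * f 1\<close>.\<close>

lemma discrete_poisson_gap:
  fixes f :: "nat \<Rightarrow> real"
  assumes "\<And>i. Suc i < L \<Longrightarrow> f (Suc i) = 1 + (f i + f (i + 2)) / 2" and "0 < L"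
  shows "real L * f 1 = (real L - 1) * f 0 + f L + real L * (real L - 1)"
proof -
  have "f i = f 0 + real i * (f 1 - f 0 + 1) - (real i)\<^sup>2" if "i \<le> L" for i
    using that
  proof (induction i rule: induct_nat_012)
    case (ge2 i)
    have "f (Suc (Suc i)) = 2 * f (Suc i) - f i - 2"
      using assms(1)[of i] ge2.prems by (simp add: field_simps)
    also have "\<dots> = f 0 + real (Suc (Suc i)) * (f 1 - f 0 + 1) - (real (Suc (Suc i)))\<^sup>2"
      using ge2 by (simp add: power2_eq_square algebra_simps)
    finally show ?case .
  qed simp_all
  from this[of L] show ?thesis by (simp add: power2_eq_square algebra_simps)
qed

lemma double_exponential_bound:
  fixes R :: "nat \<Rightarrow> real"
  assumes "\<And>k. 1 \<le> k \<Longrightarrow> R (Suc k) \<le> (R k)\<^sup>2" and "\<And>k. 1 \<le> R k" and "1 \<le> k"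
  shows "R k \<le> R 1 ^ 2 ^ k"
  using \<open>1 \<le> k\<close>
proof (induction k rule: dec_induct)
  \<comment> \<open>At \<open>k = 1\<close> the exponent is already 2, hence the use of
    \<open>1 \<le> R 1\<close>.\<close>
  case base
  show ?case using self_le_power[of "R 1" 2] assms(2)[of 1] by simp
next
  case (step k)
  have "R (Suc k) \<le> (R k)\<^sup>2" using assms(1) step.hyps by simp
  also have "\<dots> \<le> (R 1 ^ 2 ^ k)\<^sup>2"
    using step.IH assms(2)[of k] by (intro power_mono) auto
  finally show ?case by (simp add: power_mult[symmetric] mult.commute)
qed

text \<open>\<open>h\<close> abstracts the real expected absorption time, seen through its boundary
  value, sign and one-step equations. Trap indices start at 1, so \<open>x 0\<close> is
  arbitrary.\<close>

locale noncritical_traps =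
  fixes x :: "nat \<Rightarrow> nat" and h :: "nat \<Rightarrow> real"
  assumes pos: "0 < x 1"
    and less: "\<And>k. 1 \<le> k \<Longrightarrow> x k < x (Suc k)"
    and h_0: "h 0 = 0"
    and h_nonneg: "\<And>n. 0 \<le> h n"
    and h_Suc: "\<And>m. h (Suc m) = 1 + (h m + h (m + 2)) / (if Suc m \<in> x ` {1..} then 3 else 2)"
begin

lemma strict_mono_traps: "1 \<le> j \<Longrightarrow> j < k \<Longrightarrow> x j < x k"
proof (induction k)
  case (Suc k)
  then show ?case using less[of k] by (cases "j = k") auto
qed simp

lemma traps_ge_1: "1 \<le> k \<Longrightarrow> 1 \<le> x k"
  using strict_mono_traps[of 1 k] pos by (cases "k = 1") auto

lemma not_trap_gap:
  assumes "1 \<le> k" "x k < n" "n < x (Suc k)"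
  shows "n \<notin> x ` {1..}"
proof
  assume "n \<in> x ` {1..}"
  then obtain j where j: "n = x j" "1 \<le> j" by auto
  show False
  proof (cases "j \<le> k")
    case True
    then show ?thesis using strict_mono_traps[of j k] j assms by (cases "j = k") auto
  next
    case False
    then show ?thesis using strict_mono_traps[of "Suc k" j] j assms by (cases "j = Suc k") auto
  qed
qed

lemma not_trap_below_first:
  assumes "n < x 1"
  shows "n \<notin> x ` {1..}"
proof
  assume "n \<in> x ` {1..}"
  then obtain j where "n = x j" "1 \<le> j" by auto
  then show False using strict_mono_traps[of 1 j] assms by (cases "j = 1") auto
qed

text \<open>The gap identity applies on [0, \<open>x 1\<close>], whose interior has no trap; its
  quadratic term is nonnegative and is dropped.\<close>

lemma h_first_trap_le: "h (x 1) \<le> real (x 1) * h 1"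
proof -
  have "real (x 1) * h 1 = (real (x 1) - 1) * h 0 + h (x 1) + real (x 1) * (real (x 1) - 1)"
  proof (rule discrete_poisson_gap)
    show "h (Suc i) = 1 + (h i + h (i + 2)) / 2" if "Suc i < x 1" for i
      using h_Suc[of i] not_trap_below_first[OF that] by simp
  qed (rule pos)
  then show ?thesis using pos h_0 by simp
qed

lemma h_next_trap_le:
  assumes "1 \<le> k"
  defines "L \<equiv> real (x (Suc k) - x k)"
  shows "h (x (Suc k)) \<le> 3 * L * h (x k)" and "L \<le> 3 * h (x k)"
proof -
  have L: "1 \<le> L" using less[OF assms(1)] by (simp add: L_def)
  have "L * h (x k + 1) = (L - 1) * h (x k + 0) + h (x k + (x (Suc k) - x k)) + L * (L - 1)"
    unfolding L_def
  proof (rule discrete_poisson_gap)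
    fix i assume i: "Suc i < x (Suc k) - x k"
    then have "Suc (x k + i) \<notin> x ` {1..}"
      using not_trap_gap[OF assms(1)] by simp
    then show "h (x k + Suc i) = 1 + (h (x k + i) + h (x k + (i + 2))) / 2"
      using h_Suc[of "x k + i"] by (simp add: add.assoc)
  qed (use less[OF assms(1)] in simp)
  then have gap: "L * h (x k + 1) = (L - 1) * h (x k) + h (x (Suc k)) + L * (L - 1)"
    using less[OF assms(1)] by simp
  obtain m where m: "x k = Suc m"
    using traps_ge_1[OF assms(1)] by (cases "x k") auto
  have "x k \<in> x ` {1..}" using assms(1) by auto
  then have "h (x k) = 1 + (h m + h (x k + 1)) / 3"
    using h_Suc[of m] m by simp
  \<comment> \<open>Dropping the left neighbour leaves the factor 3, the number of successors of a
    trap.\<close>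
  then have right: "h (x k + 1) \<le> 3 * h (x k) - 3"
    using h_nonneg[of m] by simp
  have rest: "0 \<le> (L - 1) * h (x k)" "0 \<le> L * (L - 1)"
    using L h_nonneg by simp_all
  have "L * h (x k + 1) \<le> L * (3 * h (x k) - 3)"
    using right L by (intro mult_left_mono) auto
  then have "L * h (x k + 1) \<le> 3 * L * h (x k) - 3 * L"
    by (simp add: right_diff_distrib)
  then show "h (x (Suc k)) \<le> 3 * L * h (x k)"
    using gap rest L by linarith
  \<comment> \<open>Keeping only the quadratic term bounds the gap itself: a long gap makes
    \<open>h (x k + 1)\<close> large.\<close>
  have "L * (L - 1) \<le> L * h (x k + 1)"
    using gap rest h_nonneg[of "x (Suc k)"] by linarith
  then have "L - 1 \<le> h (x k + 1)"
    using L by simp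
  then show "L \<le> 3 * h (x k)" using right by simp
qed

section \<open>Growth of the products of traps\<close>

lemma prod_traps_pos: "0 < (\<Prod>j=1..k. x j)"
proof (rule prod_pos)
  show "0 < x j" if "j \<in> {1..k}" for j using traps_ge_1[of j] that by simp
qed

lemma prod_traps_ge:
  assumes "1 \<le> k"
  shows "x k \<le> (\<Prod>j=1..k. x j)"
proof -
  obtain m where k: "k = Suc m" using assms by (cases k) auto
  show ?thesis
    using prod_traps_pos[of m] by (simp add: k Suc_le_eq del: prod_pos_nat_iff)
qed

text \<open>Each gap multiplies \<open>h\<close> by at most three times its length, which is at most
  the next trap. The 3 on the left matches the bound on gap lengths.\<close>

lemma h_trap_le:
  assumes "1 \<le> k"
  shows "3 * h (x k) \<le> 3 ^ k * real (\<Prod>j=1..k. x j) * h 1"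
  using assms
proof (induction k rule: dec_induct)
  case base
  show ?case using h_first_trap_le by simp
next
  case (step k)
  have "3 * h (x (Suc k)) \<le> 3 * (3 * real (x (Suc k) - x k) * h (x k))"
    using h_next_trap_le(1)[OF step.hyps(1)] by (simp add: mult_ac)
  also have "\<dots> \<le> 3 * real (x (Suc k)) * (3 * h (x k))"
    using h_nonneg[of "x k"] by (simp add: mult_right_mono)
  also have "\<dots> \<le> 3 * real (x (Suc k)) * (3 ^ k * real (\<Prod>j=1..k. x j) * h 1)"
    using step.IH by (intro mult_left_mono) auto
  finally show ?case by (simp add: mult_ac)
qed

text \<open>The next trap is \<open>x k\<close> plus a gap of length at most
  \<open>3 * h (x k)\<close>. Bounding \<open>x k\<close> by the product accounts for the 1 in
  \<open>1 + h 1\<close>.\<close>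

lemma trap_Suc_le:
  assumes "1 \<le> k"
  shows "real (x (Suc k)) \<le> (1 + h 1) * 3 ^ k * real (\<Prod>j=1..k. x j)"
proof -
  define p where "p = real (\<Prod>j=1..k. x j)"
  have "p \<le> 3 ^ k * p"
    using mult_right_mono[OF one_le_power[of "3 :: real" k], of p] by (simp add: p_def prod_nonneg)
  moreover have "real (x k) \<le> p"
    unfolding p_def of_nat_le_iff by (rule prod_traps_ge[OF assms])
  moreover have "real (x (Suc k)) \<le> real (x k) + 3 * h (x k)"
    using h_next_trap_le(2)[OF assms] less[OF assms] by simp
  moreover have "3 * h (x k) \<le> 3 ^ k * p * h 1"
    unfolding p_def by (rule h_trap_le[OF assms])
  ultimately have "real (x (Suc k)) \<le> 3 ^ k * p + 3 ^ k * p * h 1"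
    by linarith
  then show ?thesis
    unfolding p_def[symmetric] by (simp add: algebra_simps)
qed

text \<open>The recursion is run on products, since each new trap is bounded by the product of all
  earlier ones.\<close>

lemma traps_double_exponential:
  obtains a :: real where "1 < a" "\<And>k. 1 \<le> k \<Longrightarrow> real (x k) \<le> a ^ 2 ^ k"
proof -
  define P where "P k = real (\<Prod>j=1..k. x j)" for k
  define C where "C = 1 + h 1"
  \<comment> \<open>The normalisation turns \<open>P (Suc k) \<le> C * 3 ^ k * (P k)\<^sup>2\<close> into \<open>R (Suc k) \<le> (R k)\<^sup>2\<close>.\<close>
  define R where "R k = C * 3 ^ Suc k * P k" for k
  have C: "1 \<le> C" using h_nonneg by (simp add: C_def)
  have P: "1 \<le> P k" for k
    using prod_traps_pos[of k] by (simp add: P_def real_of_nat_ge_one_iff Suc_le_eq del: of_nat_prod)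
  \<comment> \<open>The factor 3 ensures that the witness \<open>R 1\<close> for \<open>a\<close>
    exceeds 1 strictly.\<close>
  have P_le_R: "3 * P k \<le> R k" for k
  proof -
    have "1 * 3 \<le> C * 3 ^ Suc k"
      using C by (intro mult_mono) auto
    then show ?thesis
      unfolding R_def using P[of k] by (intro mult_right_mono) auto
  qed
  have R_Suc: "R (Suc k) \<le> (R k)\<^sup>2" if "1 \<le> k" for k
  proof -
    have "P (Suc k) = P k * real (x (Suc k))" by (simp add: P_def)
    also have "\<dots> \<le> P k * (C * 3 ^ k * P k)"
      using trap_Suc_le[OF that] P[of k] by (intro mult_left_mono) (auto simp: P_def C_def)
    \<comment> \<open>The powers of 3 balance: (k + 2) + k = 2 * (k + 1).\<close>
    finally have "R (Suc k) \<le> C * 3 ^ Suc (Suc k) * (P k * (C * 3 ^ k * P k))"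
      unfolding R_def using C by (intro mult_left_mono) auto
    then show ?thesis by (simp add: R_def power2_eq_square mult_ac)
  qed
  have R_ge: "3 \<le> R k" for k
    using P_le_R[of k] P[of k] by simp
  show ?thesis
  proof (rule that)
    show "1 < R 1" using R_ge[of 1] by simp
    fix k :: nat assume k: "1 \<le> k"
    have "real (x k) \<le> P k"
      using prod_traps_ge[OF k] by (simp only: P_def of_nat_le_iff)
    also have "\<dots> \<le> R k" using P_le_R[of k] P[of k] by simp
    also have "\<dots> \<le> R 1 ^ 2 ^ k"
    proof (rule double_exponential_bound[of R])
      show "1 \<le> R k" for k using R_ge[of k] by simp
    qed (use R_Suc k in auto)
    finally show "real (x k) \<le> R 1 ^ 2 ^ k" .
  qed
qed

end

theorem corollary2p14:
  fixes x :: "nat \<Rightarrow> nat"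
  assumes "0 < x 1"
    and "\<And>k. 1 \<le> k \<Longrightarrow> x k < x (Suc k)"
    and "\<And>a::real. 1 < a \<Longrightarrow> \<exists>k\<ge>1. real (x k) > a ^ (2 ^ k)"
  shows "critical (x ` {1..})"
proof (rule ccontr)
  let ?D = "x ` {1..}"
  assume "\<not> critical ?D"
  then have fin: "expected_absorption_time ?D 1 < \<infinity>"
    by (simp add: critical_def less_top)
  \<comment> \<open>Finiteness at site 1 yields the real-valued one-step equations; the value at 0
    vanishes because that site is absorbing.\<close>
  interpret noncritical_traps x "\<lambda>n. enn2real (expected_absorption_time ?D n)"
  proof
    show "enn2real (expected_absorption_time ?D (Suc m)) =
        1 + (enn2real (expected_absorption_time ?D m) + enn2real (expected_absorption_time ?D (m + 2))) /
          (if Suc m \<in> ?D then 3 else 2)" for m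
      by (rule enn2real_expected_absorption_time_Suc[OF fin])
  qed (use assms(1,2) in \<open>simp_all add: expected_absorption_time_0\<close>)
  obtain a :: real where "1 < a" "\<And>k. 1 \<le> k \<Longrightarrow> real (x k) \<le> a ^ 2 ^ k"
    by (rule traps_double_exponential) blast
  then show False using assms(3)[of a] by (auto simp: not_le[symmetric])
qed

end
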